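(* Let $T_1,\dots,T_C$ be test statistics with rejection regions (events) $R_1,\dots,R_C$, each test having exact level $\alpha$, i.e. $\mathbb P(R_i)=\alpha$. Then $$\mathrm{FWER}=\mathbb P\Big(\bigcup_{i} R_i\Big)\ge\alpha,$$ with equality if and only if $\mathbb P(R_i\,\triangle\,R_j)=0$ for all $i,j$. In particular, for tests $T_i\sim\mathcal N(0,1)$ under the global null, equality occurs if and only if $\rho_{ij}=1$ for all $i,j$.
   Context: FWER (familywise error rate) is the probability, under the global null, that at least one of the tests rejects. $\triangle$ denotes symmetric difference of events. In the last sentence, $T_1,\dots,T_C$ are jointly normal with $T_i\sim\mathcal N(0,1)$, $\rho_{ij}$ is the correlation of $T_i$ and $T_j$, and the tests are two-sided: $R_i=\{|T_i|>c_{\alpha/2}\}$, where $\mathbb P(|T_i|>c_{\alpha/2})=\alpha$. All probabilities are under the global null.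
   Formalization: For two-sided tests the last sentence fails if T_2 = -T_1 (rho_12 = -1, yet FWER = alpha) and if alpha = 1; proved instead for 0 < alpha < 1: equality iff |rho_ij| = 1 for all i,j, and iff rho_ij = 1 for all i,j when no rho_ij equals -1. *)

theory Defs
  imports "HOL-Probability.Probability"
begin

definition fwer :: "'a measure \<Rightarrow> 'i set \<Rightarrow> ('i \<Rightarrow> 'a set) \<Rightarrow> real" where
  "fwer M I R = measure M {\<omega> \<in> space M. \<exists>i\<in>I. \<omega> \<in> R i}"

definition covariance :: "'a measure \<Rightarrow> ('a \<Rightarrow> real) \<Rightarrow> ('a \<Rightarrow> real) \<Rightarrow> real" where
  "covariance M X Y =
     (\<integral>\<omega>. (X \<omega> - (\<integral>\<omega>'. X \<omega>' \<partial>M)) * (Y \<omega> - (\<integral>\<omega>'. Y \<omega>' \<partial>M)) \<partial>M)"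

definition correlation :: "'a measure \<Rightarrow> ('a \<Rightarrow> real) \<Rightarrow> ('a \<Rightarrow> real) \<Rightarrow> real" where
  "correlation M X Y = covariance M X Y / sqrt (covariance M X X * covariance M Y Y)"

text \<open>Univariate normal law, with the point mass at the mean as the case of zero variance.
  The library constant \<open>normal_density\<close> is only a density for positive standard deviation.\<close>

definition normal_rv :: "'a measure \<Rightarrow> ('a \<Rightarrow> real) \<Rightarrow> bool" where
  "normal_rv M X \<longleftrightarrow>
     (\<exists>\<mu> \<sigma>. 0 < \<sigma> \<and> distributed M lborel X (normal_density \<mu> \<sigma>)) \<or>
     (\<exists>\<mu>. X \<in> borel_measurable M \<and> (AE \<omega> in M. X \<omega> = \<mu>))"

text \<open>Joint normality in the usual sense that every linear combination is normal. Singular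
  covariance matrices are included; perfectly correlated families require this.\<close>

definition jointly_normal :: "'a measure \<Rightarrow> 'i set \<Rightarrow> ('i \<Rightarrow> 'a \<Rightarrow> real) \<Rightarrow> bool" where
  "jointly_normal M I T \<longleftrightarrow> (\<forall>a :: 'i \<Rightarrow> real. normal_rv M (\<lambda>\<omega>. \<Sum>i\<in>I. a i * T i \<omega>))"

end

theory Submission
  imports Defs
begin

text \<open>The union of the rejection regions has probability \<open>\<alpha>\<close> iff every region fills it up to a null
  set. For jointly standard normal \<open>X\<close>, \<open>Y\<close> with correlation \<open>\<rho>\<close>, the residual \<open>Z = Y - \<rho> X\<close> has
  variance \<open>1 - \<rho>\<^sup>2\<close>. If \<open>\<bar>\<rho>\<bar> = 1\<close> it vanishes and the two-sided regions agree almost surely. Otherwise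
  it is a nondegenerate normal variable independent of \<open>X\<close>, so with positive probability \<open>\<bar>X\<bar> \<le> c\<close>
  while \<open>Z > (1 + \<bar>\<rho>\<bar>) c\<close>, which forces \<open>Y > c\<close>.\<close>

context prob_space
begin

section \<open>Characteristic functions and product probabilities\<close>

text \<open>A signed version of Levy's uniqueness theorem. An affine change turns \<open>g\<close>
  into a positive weight \<open>w\<close> of mean 1. Reweighting by \<open>w\<close> leaves the
  characteristic function of \<open>X\<close> unchanged, hence also its law; undoing the affine
  change gives the claim for \<open>g\<close>.\<close>

lemma char_weighted_uniqueness:
  fixes X g :: "'a \<Rightarrow> real" and c :: real
  assumes X [measurable]: "X \<in> borel_measurable M"
    and g [measurable]: "g \<in> borel_measurable M"
    and bound: "\<And>\<omega>. \<bar>g \<omega>\<bar> \<le> 1"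
    and char_eq: "\<And>u. (CLINT \<omega>|M. of_real (g \<omega>) * iexp (u * X \<omega>)) = of_real c * (CLINT \<omega>|M. iexp (u * X \<omega>))"
    and A [measurable]: "A \<in> sets borel"
  shows "(LINT \<omega>|M. g \<omega> * indicator A (X \<omega>)) = c * prob (X -` A \<inter> space M)"
proof -
  have intg: "integrable M g"
    by (rule integrable_const_bound[of _ 1]) (use bound in auto)
  have iX: "complex_integrable M (\<lambda>\<omega>. iexp (u * X \<omega>))" for u
    by (rule integrable_const_bound[of _ 1]) auto
  have igX: "complex_integrable M (\<lambda>\<omega>. of_real (g \<omega>) * iexp (u * X \<omega>))" for u
    by (rule integrable_const_bound[of _ 1]) (use bound in \<open>auto simp: norm_mult\<close>)
  \<comment> \<open>Frequency 0 identifies the constant as the mean of \<open>g\<close>, so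
    \<open>c\<close> inherits the bound on \<open>g\<close>.\<close>
  have "complex_of_real c = of_real (expectation g)"
    using char_eq[of 0] by (simp add: prob_space)
  then have c: "c = expectation g"
    by (simp only: of_real_eq_iff)
  have "\<bar>expectation g\<bar> \<le> expectation (\<lambda>\<omega>. \<bar>g \<omega>\<bar>)"
    by (rule integral_abs_bound)
  also have "\<dots> \<le> expectation (\<lambda>_. 1)"
    using bound intg by (intro integral_mono) auto
  finally have c1: "\<bar>c\<bar> \<le> 1"
    by (simp add: c prob_space)
  \<comment> \<open>With both \<open>g\<close> and \<open>c\<close> in [-1, 1], the shift by 2 keeps
    numerator and denominator at least 1; a shift by 1 would fail at \<open>c = -1\<close>.\<close>
  define w where "w \<omega> = (2 + g \<omega>) / (2 + c)" for \<omega>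
  have w [measurable]: "w \<in> borel_measurable M"
    unfolding w_def by measurable
  have w0: "0 \<le> w \<omega>" for \<omega>
    using bound[of \<omega>] c1 by (auto simp: w_def)
  have intw: "integrable M w"
    unfolding w_def using intg by auto
  have "expectation w = 1"
    unfolding w_def using intg c1 by (simp add: c[symmetric] prob_space)
  then have "(\<integral>\<^sup>+\<omega>. ennreal (w \<omega>) \<partial>M) = 1"
    using intw w0 by (simp add: nn_integral_eq_integral)
  then interpret W: prob_space "density M (\<lambda>\<omega>. ennreal (w \<omega>))"
    by (intro prob_spaceI) (simp add: emeasure_density cong: nn_integral_cong)
  \<comment> \<open>If \<open>\<phi>\<close> is the characteristic function of \<open>X\<close>, the
    reweighted one is \<open>(2 * \<phi> + c * \<phi>) / (2 + c) = \<phi>\<close>.\<close>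
  have "char (distr (density M (\<lambda>\<omega>. ennreal (w \<omega>))) borel X) u = char (distr M borel X) u" for u
  proof -
    have "char (distr (density M (\<lambda>\<omega>. ennreal (w \<omega>))) borel X) u = (CLINT \<omega>|M. w \<omega> *\<^sub>R iexp (u * X \<omega>))"
      unfolding char_def by (subst integral_distr) (auto simp: integral_density w0)
    also have "\<dots> = (CLINT \<omega>|M. (2 * iexp (u * X \<omega>) + of_real (g \<omega>) * iexp (u * X \<omega>)) / of_real (2 + c))"
      by (intro Bochner_Integration.integral_cong refl)
         (simp add: w_def scaleR_conv_of_real add_divide_distrib distrib_right)
    also have "\<dots> = (2 * (CLINT \<omega>|M. iexp (u * X \<omega>)) + of_real c * (CLINT \<omega>|M. iexp (u * X \<omega>))) / of_real (2 + c)"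
      using iX[of u] igX[of u] char_eq[of u]
      by (simp only: integral_divide_zero integral_mult_right_zero Bochner_Integration.integral_add integrable_mult_right)
    also have "\<dots> = (CLINT \<omega>|M. iexp (u * X \<omega>))"
    proof -
      have "complex_of_real (2 + c) \<noteq> 0"
        using c1 by (simp only: of_real_eq_0_iff)
      then show ?thesis
        by (simp add: field_simps)
    qed
    also have "\<dots> = char (distr M borel X) u"
      unfolding char_def by (subst integral_distr) auto
    finally show ?thesis .
  qed
  then have "distr (density M (\<lambda>\<omega>. ennreal (w \<omega>))) borel X = distr M borel X"
    by (intro Levy_uniqueness ext W.real_distribution_distr real_distribution_distr) auto
  then have "measure (distr (density M (\<lambda>\<omega>. ennreal (w \<omega>))) borel X) A = measure (distr M borel X) A"
    by simp
  moreover have "measure (distr M borel X) A = (LINT \<omega>|M. indicator A (X \<omega>))"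
    by (subst integral_distr[symmetric, where N=borel]) auto
  moreover have "measure (distr (density M (\<lambda>\<omega>. ennreal (w \<omega>))) borel X) A = (LINT \<omega>|M. w \<omega> * indicator A (X \<omega>))"
  proof -
    have "measure (distr (density M (\<lambda>\<omega>. ennreal (w \<omega>))) borel X) A =
        (LINT x|distr (density M (\<lambda>\<omega>. ennreal (w \<omega>))) borel X. indicator A x)"
      by auto
    also have "\<dots> = (LINT \<omega>|M. w \<omega> * indicator A (X \<omega>))"
      by (subst integral_distr) (auto simp: integral_density w0)
    finally show ?thesis .
  qed
  moreover have "(LINT \<omega>|M. w \<omega> * indicator A (X \<omega>)) =
      (2 * (LINT \<omega>|M. indicator A (X \<omega>)) + (LINT \<omega>|M. g \<omega> * indicator A (X \<omega>))) / (2 + c)"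
  proof -
    have "integrable M (\<lambda>\<omega>. indicator A (X \<omega>) :: real)" "integrable M (\<lambda>\<omega>. g \<omega> * indicator A (X \<omega>))"
      by (rule integrable_const_bound[of _ 1]; use bound in \<open>auto simp: indicator_def\<close>)+
    moreover have "w \<omega> * indicator A (X \<omega>) = (2 * indicator A (X \<omega>) + g \<omega> * indicator A (X \<omega>)) / (2 + c)" for \<omega>
      by (simp add: w_def add_divide_distrib distrib_right)
    ultimately show ?thesis
      by simp
  qed
  moreover have "measure (distr M borel X) A = prob (X -` A \<inter> space M)"
    by (rule measure_distr) auto
  \<comment> \<open>Writing \<open>p\<close> for the probability that \<open>X\<close> lies in
    \<open>A\<close> and \<open>e\<close> for the integral sought, the facts collected give
    \<open>p = (2 * p + e) / (2 + c)\<close>, so \<open>e = c * p\<close>.\<close>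
  ultimately show ?thesis
    using c1 by (simp add: field_simps)
qed

text \<open>Kac's criterion. Conditioning the law of \<open>X\<close> on the complex weight \<open>iexp (v * Z)\<close> does not
  change its characteristic function up to a constant; cosine and sine make this weight real.\<close>

lemma prob_vimage_Int_eq_mult_if_char_factorizes:
  fixes X Z :: "'a \<Rightarrow> real"
  assumes X [measurable]: "X \<in> borel_measurable M" and Z [measurable]: "Z \<in> borel_measurable M"
    and fact: "\<And>u v. (CLINT \<omega>|M. iexp (u * X \<omega> + v * Z \<omega>)) =
      (CLINT \<omega>|M. iexp (u * X \<omega>)) * (CLINT \<omega>|M. iexp (v * Z \<omega>))"
    and A [measurable]: "A \<in> sets borel" and B [measurable]: "B \<in> sets borel"
  shows "prob ((X -` A \<inter> space M) \<inter> (Z -` B \<inter> space M)) = prob (X -` A \<inter> space M) * prob (Z -` B \<inter> space M)"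
proof -
  have i2: "complex_integrable M (\<lambda>\<omega>. iexp (u * X \<omega> + v * Z \<omega>))" for u v
    by (rule integrable_const_bound[of _ 1]) auto
  have i1: "complex_integrable M (\<lambda>\<omega>. iexp (v * Z \<omega>))" for v
    by (rule integrable_const_bound[of _ 1]) auto
  have icos: "integrable M (\<lambda>\<omega>. cos (v * Z \<omega>))" and isin: "integrable M (\<lambda>\<omega>. sin (v * Z \<omega>))" for v
    by (rule integrable_const_bound[of _ 1]; auto)+
  have cos_iexp: "complex_of_real (cos t) = (iexp t + iexp (-t)) / 2"
    and sin_iexp: "complex_of_real (sin t) = (iexp t - iexp (-t)) / (2 * \<i>)" for t :: real
    by (simp_all add: cos_of_real[symmetric] sin_of_real[symmetric] cos_exp_eq sin_exp_eq)
  have iexp_add: "iexp (s + t) = iexp s * iexp t" for s t :: real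
    by (simp add: exp_add distrib_left)
  \<comment> \<open>Adding the factorizations at \<open>v\<close> and \<open>-v\<close> isolates the
    cosine weight; subtracting them isolates the sine weight in \<open>sinA\<close>.\<close>
  have cosA: "(LINT \<omega>|M. cos (v * Z \<omega>) * indicator A (X \<omega>)) =
      (LINT \<omega>|M. cos (v * Z \<omega>)) * prob (X -` A \<inter> space M)" for v
  proof (rule char_weighted_uniqueness)
    fix u
    have "(CLINT \<omega>|M. of_real (cos (v * Z \<omega>)) * iexp (u * X \<omega>)) =
        (CLINT \<omega>|M. (iexp (u * X \<omega> + v * Z \<omega>) + iexp (u * X \<omega> + (-v) * Z \<omega>)) / 2)"
      by (intro Bochner_Integration.integral_cong refl)
         (simp only: cos_iexp iexp_add, simp add: field_simps)
    also have "\<dots> = (CLINT \<omega>|M. iexp (u * X \<omega>)) * (((CLINT \<omega>|M. iexp (v * Z \<omega>)) + (CLINT \<omega>|M. iexp ((-v) * Z \<omega>))) / 2)"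
      by (simp only: integral_divide_zero Bochner_Integration.integral_add[OF i2 i2] fact distrib_left times_divide_eq_right)
    also have "((CLINT \<omega>|M. iexp (v * Z \<omega>)) + (CLINT \<omega>|M. iexp ((-v) * Z \<omega>))) / 2 =
        (CLINT \<omega>|M. of_real (cos (v * Z \<omega>)))"
      by (simp only: integral_divide_zero[symmetric] Bochner_Integration.integral_add[OF i1 i1, symmetric] cos_iexp)
         simp
    finally show "(CLINT \<omega>|M. of_real (cos (v * Z \<omega>)) * iexp (u * X \<omega>)) =
        of_real (LINT \<omega>|M. cos (v * Z \<omega>)) * (CLINT \<omega>|M. iexp (u * X \<omega>))"
      by (simp only: integral_complex_of_real mult.commute)
  qed auto
  have sinA: "(LINT \<omega>|M. sin (v * Z \<omega>) * indicator A (X \<omega>)) =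
      (LINT \<omega>|M. sin (v * Z \<omega>)) * prob (X -` A \<inter> space M)" for v
  proof (rule char_weighted_uniqueness)
    fix u
    have "(CLINT \<omega>|M. of_real (sin (v * Z \<omega>)) * iexp (u * X \<omega>)) =
        (CLINT \<omega>|M. (iexp (u * X \<omega> + v * Z \<omega>) - iexp (u * X \<omega> + (-v) * Z \<omega>)) / (2 * \<i>))"
      by (intro Bochner_Integration.integral_cong refl)
         (simp only: sin_iexp iexp_add, simp add: field_simps)
    also have "\<dots> = (CLINT \<omega>|M. iexp (u * X \<omega>)) * (((CLINT \<omega>|M. iexp (v * Z \<omega>)) - (CLINT \<omega>|M. iexp ((-v) * Z \<omega>))) / (2 * \<i>))"
      by (simp only: integral_divide_zero Bochner_Integration.integral_diff[OF i2 i2] fact right_diff_distrib times_divide_eq_right)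
    also have "((CLINT \<omega>|M. iexp (v * Z \<omega>)) - (CLINT \<omega>|M. iexp ((-v) * Z \<omega>))) / (2 * \<i>) =
        (CLINT \<omega>|M. of_real (sin (v * Z \<omega>)))"
      by (simp only: integral_divide_zero[symmetric] Bochner_Integration.integral_diff[OF i1 i1, symmetric] sin_iexp)
         simp
    finally show "(CLINT \<omega>|M. of_real (sin (v * Z \<omega>)) * iexp (u * X \<omega>)) =
        of_real (LINT \<omega>|M. sin (v * Z \<omega>)) * (CLINT \<omega>|M. iexp (u * X \<omega>))"
      by (simp only: integral_complex_of_real mult.commute)
  qed auto
  have iexp_cos_sin: "iexp t = of_real (cos t) + \<i> * of_real (sin t)" for t :: real
    by (simp add: exp_Euler cos_of_real sin_of_real)
  \<comment> \<open>The uniqueness lemma is applied again with the roles exchanged: the variable is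
    now \<open>Z\<close>, and the weight is the indicator of \<open>X\<close> lying in
    \<open>A\<close>. Its hypothesis is \<open>cosA\<close> and \<open>sinA\<close> recombined by
    Euler's formula.\<close>
  have "(LINT \<omega>|M. indicator A (X \<omega>) * indicator B (Z \<omega>)) = prob (X -` A \<inter> space M) * prob (Z -` B \<inter> space M)"
  proof (rule char_weighted_uniqueness)
    fix v
    have icA: "integrable M (\<lambda>\<omega>. cos (v * Z \<omega>) * indicator A (X \<omega>))"
      and isA: "integrable M (\<lambda>\<omega>. sin (v * Z \<omega>) * indicator A (X \<omega>))"
      by (rule integrable_const_bound[of _ 1]; auto simp: indicator_def)+
    have "(CLINT \<omega>|M. of_real (indicator A (X \<omega>)) * iexp (v * Z \<omega>)) =
       (CLINT \<omega>|M. of_real (cos (v * Z \<omega>) * indicator A (X \<omega>)) + \<i> * of_real (sin (v * Z \<omega>) * indicator A (X \<omega>)))"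
      by (intro Bochner_Integration.integral_cong refl)
         (simp only: iexp_cos_sin, simp add: algebra_simps)
    also have "\<dots> = of_real (LINT \<omega>|M. cos (v * Z \<omega>) * indicator A (X \<omega>)) + \<i> * of_real (LINT \<omega>|M. sin (v * Z \<omega>) * indicator A (X \<omega>))"
      by (subst Bochner_Integration.integral_add)
         (use icA isA in \<open>auto simp only: integral_mult_right_zero integral_complex_of_real integrable_mult_right complex_of_real_integrable_eq\<close>)
    also have "\<dots> = of_real (prob (X -` A \<inter> space M)) * (of_real (LINT \<omega>|M. cos (v * Z \<omega>)) + \<i> * of_real (LINT \<omega>|M. sin (v * Z \<omega>)))"
      by (simp only: cosA sinA of_real_mult) (simp add: algebra_simps)
    also have "of_real (LINT \<omega>|M. cos (v * Z \<omega>)) + \<i> * of_real (LINT \<omega>|M. sin (v * Z \<omega>)) = (CLINT \<omega>|M. iexp (v * Z \<omega>))"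
      unfolding iexp_cos_sin
      by (subst Bochner_Integration.integral_add)
         (use icos isin in \<open>auto simp only: integral_mult_right_zero integral_complex_of_real integrable_mult_right complex_of_real_integrable_eq\<close>)
    finally show "(CLINT \<omega>|M. of_real (indicator A (X \<omega>)) * iexp (v * Z \<omega>)) =
        of_real (prob (X -` A \<inter> space M)) * (CLINT \<omega>|M. iexp (v * Z \<omega>))" .
  qed (auto simp: indicator_def)
  moreover have "(LINT \<omega>|M. indicator A (X \<omega>) * indicator B (Z \<omega>)) =
      (LINT \<omega>|M. indicator ((X -` A \<inter> space M) \<inter> (Z -` B \<inter> space M)) \<omega> :: real)"
    by (intro Bochner_Integration.integral_cong) (auto simp: indicator_def)
  ultimately show ?thesis
    by simp
qed

section \<open>Second moments and centred normal variables\<close>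

lemma integrable_mult_if_square_integrable:
  fixes X Y :: "'a \<Rightarrow> real"
  assumes [measurable]: "X \<in> borel_measurable M" "Y \<in> borel_measurable M"
    and "integrable M (\<lambda>\<omega>. (X \<omega>)\<^sup>2)" "integrable M (\<lambda>\<omega>. (Y \<omega>)\<^sup>2)"
  shows "integrable M (\<lambda>\<omega>. X \<omega> * Y \<omega>)"
proof (rule Bochner_Integration.integrable_bound)
  show "integrable M (\<lambda>\<omega>. (X \<omega>)\<^sup>2 + (Y \<omega>)\<^sup>2)"
    using assms by auto
  have "\<bar>x * y\<bar> \<le> x\<^sup>2 + y\<^sup>2" for x y :: real
    using sum_squares_bound[of "\<bar>x\<bar>" "\<bar>y\<bar>"] mult_nonneg_nonneg[of "\<bar>x\<bar>" "\<bar>y\<bar>"]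
    by (simp add: abs_mult del: mult_nonneg_nonneg)
  then show "AE \<omega> in M. norm (X \<omega> * Y \<omega>) \<le> norm ((X \<omega>)\<^sup>2 + (Y \<omega>)\<^sup>2)"
    by (intro AE_I2) (simp add: abs_of_nonneg)
qed auto

lemma expectation_square_linear_combination:
  fixes X Y :: "'a \<Rightarrow> real"
  assumes [measurable]: "X \<in> borel_measurable M" "Y \<in> borel_measurable M"
    and "integrable M (\<lambda>\<omega>. (X \<omega>)\<^sup>2)" "integrable M (\<lambda>\<omega>. (Y \<omega>)\<^sup>2)"
  shows "integrable M (\<lambda>\<omega>. (a * X \<omega> + b * Y \<omega>)\<^sup>2)"
    and "expectation (\<lambda>\<omega>. (a * X \<omega> + b * Y \<omega>)\<^sup>2) =
      a\<^sup>2 * expectation (\<lambda>\<omega>. (X \<omega>)\<^sup>2) + b\<^sup>2 * expectation (\<lambda>\<omega>. (Y \<omega>)\<^sup>2) + 2 * a * b * expectation (\<lambda>\<omega>. X \<omega> * Y \<omega>)"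
proof -
  have XY: "integrable M (\<lambda>\<omega>. X \<omega> * Y \<omega>)"
    using assms by (rule integrable_mult_if_square_integrable)
  have eq: "(a * X \<omega> + b * Y \<omega>)\<^sup>2 = a\<^sup>2 * (X \<omega>)\<^sup>2 + b\<^sup>2 * (Y \<omega>)\<^sup>2 + 2 * a * b * (X \<omega> * Y \<omega>)" for \<omega>
    by (simp add: power2_eq_square algebra_simps)
  show "integrable M (\<lambda>\<omega>. (a * X \<omega> + b * Y \<omega>)\<^sup>2)"
    and "expectation (\<lambda>\<omega>. (a * X \<omega> + b * Y \<omega>)\<^sup>2) =
      a\<^sup>2 * expectation (\<lambda>\<omega>. (X \<omega>)\<^sup>2) + b\<^sup>2 * expectation (\<lambda>\<omega>. (Y \<omega>)\<^sup>2) + 2 * a * b * expectation (\<lambda>\<omega>. X \<omega> * Y \<omega>)"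
    unfolding eq using assms XY by auto
qed

text \<open>With a density, \<open>X / \<sigma>\<close> is standard normal, and its characteristic
  function at \<open>\<sigma>\<close> is that of \<open>X\<close> at 1. For a point mass, mean zero
  makes both sides 1. Frequency 1 suffices because other frequencies are absorbed into the
  coefficients of linear combinations.\<close>

lemma normal_rv_char:
  assumes "normal_rv M X" and mean: "expectation X = 0"
  shows "(CLINT \<omega>|M. iexp (X \<omega>)) = of_real (exp (- expectation (\<lambda>\<omega>. (X \<omega>)\<^sup>2) / 2))"
  using assms(1) unfolding normal_rv_def
proof (elim disjE exE conjE)
  fix \<mu> \<sigma> :: real
  assume \<sigma>: "0 < \<sigma>" and D: "distributed M lborel X (normal_density \<mu> \<sigma>)"
  have [measurable]: "X \<in> borel_measurable M"
    using distributed_measurable[OF D] by simp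
  have "\<mu> = 0"
    using normal_distributed_expectation[OF \<sigma> D] mean by simp
  then have "distributed M lborel (\<lambda>\<omega>. X \<omega> / \<sigma>) std_normal_density"
    using D normal_standard_normal_convert[OF \<sigma>, of X \<mu>] by simp
  then have "distr M borel (\<lambda>\<omega>. X \<omega> / \<sigma>) = std_normal_distribution"
    by (subst distributed_distr_eq_density[symmetric]) (auto intro!: distr_cong)
  then have "char (distr M borel (\<lambda>\<omega>. X \<omega> / \<sigma>)) \<sigma> = of_real (exp (- \<sigma>\<^sup>2 / 2))"
    by (simp add: char_std_normal_distribution)
  moreover have "char (distr M borel (\<lambda>\<omega>. X \<omega> / \<sigma>)) \<sigma> = (CLINT \<omega>|M. iexp (X \<omega>))"
    unfolding char_def using \<sigma> by (subst integral_distr) auto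
  moreover have "expectation (\<lambda>\<omega>. (X \<omega>)\<^sup>2) = \<sigma>\<^sup>2"
    using normal_distributed_variance[OF \<sigma> D] mean by simp
  ultimately show ?thesis
    by simp
next
  fix \<mu> :: real
  assume [measurable]: "X \<in> borel_measurable M" and const: "AE \<omega> in M. X \<omega> = \<mu>"
  have "expectation X = expectation (\<lambda>_. \<mu>)"
    using const by (intro integral_cong_AE) auto
  then have "\<mu> = 0"
    using mean by (simp add: prob_space)
  then have zero: "AE \<omega> in M. X \<omega> = 0"
    using const by simp
  have "(CLINT \<omega>|M. iexp (X \<omega>)) = (CLINT \<omega>|M. 1)"
    by (rule integral_cong_AE) (use zero in auto)
  moreover have "expectation (\<lambda>\<omega>. (X \<omega>)\<^sup>2) = expectation (\<lambda>_. 0)"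
    by (rule integral_cong_AE) (use zero in auto)
  ultimately show ?thesis
    by (simp add: prob_space)
qed

text \<open>Each \<open>u * X + v * Z\<close> is centred normal. As the cross moment vanishes, its
  variance is a term in \<open>u\<close> plus a term in \<open>v\<close>, so the exponential splits
  and Kac's criterion applies.\<close>

lemma prob_vimage_Int_eq_mult_if_uncorrelated_normal:
  fixes X Z :: "'a \<Rightarrow> real"
  assumes X [measurable]: "X \<in> borel_measurable M" and Z [measurable]: "Z \<in> borel_measurable M"
    and X2: "integrable M (\<lambda>\<omega>. (X \<omega>)\<^sup>2)" and Z2: "integrable M (\<lambda>\<omega>. (Z \<omega>)\<^sup>2)"
    and mean: "expectation X = 0" "expectation Z = 0"
    and uncorr: "expectation (\<lambda>\<omega>. X \<omega> * Z \<omega>) = 0"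
    and normal: "\<And>a b. normal_rv M (\<lambda>\<omega>. a * X \<omega> + b * Z \<omega>)"
    and "A \<in> sets borel" "B \<in> sets borel"
  shows "prob ((X -` A \<inter> space M) \<inter> (Z -` B \<inter> space M)) = prob (X -` A \<inter> space M) * prob (Z -` B \<inter> space M)"
proof (rule prob_vimage_Int_eq_mult_if_char_factorizes)
  have i: "integrable M X" "integrable M Z"
    using square_integrable_imp_integrable[of X] square_integrable_imp_integrable[of Z] X2 Z2 by auto
  have char: "(CLINT \<omega>|M. iexp (u * X \<omega> + v * Z \<omega>)) =
      of_real (exp (- (u\<^sup>2 * expectation (\<lambda>\<omega>. (X \<omega>)\<^sup>2) + v\<^sup>2 * expectation (\<lambda>\<omega>. (Z \<omega>)\<^sup>2)) / 2))" for u v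
    using normal_rv_char[OF normal[of u v]] i mean uncorr
      expectation_square_linear_combination(2)[OF X Z X2 Z2, of u v] by simp
  show "(CLINT \<omega>|M. iexp (u * X \<omega> + v * Z \<omega>)) =
      (CLINT \<omega>|M. iexp (u * X \<omega>)) * (CLINT \<omega>|M. iexp (v * Z \<omega>))" for u v
  proof -
    have "(CLINT \<omega>|M. iexp (u * X \<omega>)) = of_real (exp (- (u\<^sup>2 * expectation (\<lambda>\<omega>. (X \<omega>)\<^sup>2)) / 2))"
      and "(CLINT \<omega>|M. iexp (v * Z \<omega>)) = of_real (exp (- (v\<^sup>2 * expectation (\<lambda>\<omega>. (Z \<omega>)\<^sup>2)) / 2))"
      using char[of u 0] char[of 0 v] by simp_all
    then show ?thesis
      unfolding char[of u v] by (simp only: of_real_mult[symmetric] exp_add[symmetric]) (simp add: diff_divide_distrib)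
  qed
qed fact+

section \<open>Pairs of standard normal variables\<close>

lemma std_normal_distributed_square:
  fixes X :: "'a \<Rightarrow> real"
  assumes D: "distributed M lborel X std_normal_density"
  shows "integrable M (\<lambda>\<omega>. (X \<omega>)\<^sup>2)" and "expectation (\<lambda>\<omega>. (X \<omega>)\<^sup>2) = 1"
  using distributed_integrable[OF D, of "\<lambda>x. x\<^sup>2"] integrable_std_normal_moment[of 2]
    standard_normal_distributed_variance[OF D] standard_normal_distributed_expectation[OF D]
  by auto

lemma correlation_std_normal:
  assumes "distributed M lborel X std_normal_density" "distributed M lborel Y std_normal_density"
  shows "correlation M X Y = expectation (\<lambda>\<omega>. X \<omega> * Y \<omega>)"
  using assms[THEN standard_normal_distributed_expectation] assms[THEN std_normal_distributed_square(2)]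
  by (simp add: correlation_def covariance_def power2_eq_square)

text \<open>The residual \<open>Y - \<rho> * X\<close> has second moment
  \<open>1 - \<rho>\<^sup>2 = 0\<close>, so \<open>Y = \<rho> * X\<close> almost surely, and the
  factor \<open>\<rho>\<close> is a sign.\<close>

lemma AE_abs_eq_if_abs_correlation_1:
  fixes X Y :: "'a \<Rightarrow> real"
  assumes DX: "distributed M lborel X std_normal_density" and DY: "distributed M lborel Y std_normal_density"
    and corr: "\<bar>correlation M X Y\<bar> = 1"
  shows "AE \<omega> in M. \<bar>X \<omega>\<bar> = \<bar>Y \<omega>\<bar>"
proof -
  have [measurable]: "X \<in> borel_measurable M" "Y \<in> borel_measurable M"
    using distributed_measurable[OF DX] distributed_measurable[OF DY] by simp_all
  define \<rho> where "\<rho> = correlation M X Y"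
  have \<rho>2: "\<rho>\<^sup>2 = 1"
    using corr by (metis \<rho>_def power2_abs one_power2)
  note sq = std_normal_distributed_square[OF DX] std_normal_distributed_square[OF DY]
  have "expectation (\<lambda>\<omega>. ((-\<rho>) * X \<omega> + 1 * Y \<omega>)\<^sup>2) = 1 - \<rho>\<^sup>2"
    by (subst expectation_square_linear_combination(2))
       (use sq in \<open>auto simp: correlation_std_normal[OF DX DY, symmetric] \<rho>_def[symmetric] power2_eq_square\<close>)
  then have "AE \<omega> in M. ((-\<rho>) * X \<omega> + 1 * Y \<omega>)\<^sup>2 = 0"
    using expectation_square_linear_combination(1)[of X Y "-\<rho>" 1] sq \<rho>2
    by (subst integral_nonneg_eq_0_iff_AE[symmetric]) auto
  then show ?thesis
    using corr by (auto simp: \<rho>_def[symmetric] abs_mult elim!: eventually_mono)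
qed

text \<open>The density is strictly positive, so a null tail would make a half-line Lebesgue null,
  although it contains a unit interval.\<close>

lemma prob_normal_greaterThan_pos:
  fixes Z :: "'a \<Rightarrow> real"
  assumes \<sigma>: "0 < \<sigma>" and D: "distributed M lborel Z (normal_density \<mu> \<sigma>)"
  shows "0 < prob (Z -` {t<..} \<inter> space M)"
proof (rule ccontr)
  assume "\<not> 0 < prob (Z -` {t<..} \<inter> space M)"
  then have "emeasure M (Z -` {t<..} \<inter> space M) = 0"
    by (simp add: emeasure_eq_measure zero_less_measure_iff)
  then have "(\<integral>\<^sup>+x. ennreal (normal_density \<mu> \<sigma> x) * indicator {t<..} x \<partial>lborel) = 0"
    using distributed_emeasure[OF D, of "{t<..}"] by simp
  then have "AE x in lborel. ennreal (normal_density \<mu> \<sigma> x) * indicator {t<..} x = 0"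
    by (subst nn_integral_0_iff_AE[symmetric]) auto
  then have "AE x in lborel. x \<notin> {t<..}"
  proof eventually_elim
    case (elim x)
    then show ?case
      using normal_density_pos[OF \<sigma>, of \<mu> x] by (auto simp: indicator_def split: if_splits)
  qed
  then have "emeasure lborel {t<..} = 0"
    by (subst (asm) AE_iff_measurable[of "{t<..}"]) auto
  moreover have "emeasure lborel {t<..<t+1} \<le> emeasure lborel {t<..}"
    by (rule emeasure_mono) auto
  ultimately show False
    by simp
qed

text \<open>Supplies the event on which the test based on \<open>X\<close> accepts while the one
  based on \<open>Y\<close> rejects. It is found inside a product event for \<open>X\<close> and the
  residual of \<open>Y\<close> given \<open>X\<close>.\<close>

lemma prob_abs_le_abs_greater_pos:
  fixes X Y :: "'a \<Rightarrow> real"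
  assumes DX: "distributed M lborel X std_normal_density" and DY: "distributed M lborel Y std_normal_density"
    and normal: "\<And>a b. normal_rv M (\<lambda>\<omega>. a * X \<omega> + b * Y \<omega>)"
    and corr: "\<bar>correlation M X Y\<bar> \<noteq> 1"
    and pos: "0 < prob {\<omega> \<in> space M. \<bar>X \<omega>\<bar> \<le> c}"
  shows "0 < prob {\<omega> \<in> space M. \<bar>X \<omega>\<bar> \<le> c \<and> c < \<bar>Y \<omega>\<bar>}"
proof -
  have [measurable]: "X \<in> borel_measurable M" "Y \<in> borel_measurable M"
    using distributed_measurable[OF DX] distributed_measurable[OF DY] by simp_all
  define \<rho> where "\<rho> = correlation M X Y"
  \<comment> \<open>As the second moment of \<open>X\<close> is 1, \<open>\<rho>\<close> is the
    regression coefficient of \<open>Y\<close> on \<open>X\<close>, which makes \<open>Z\<close>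
    uncorrelated with \<open>X\<close>. The factor 1 matches the form of
    \<open>expectation_square_linear_combination\<close>.\<close>
  define Z where "Z \<omega> = (-\<rho>) * X \<omega> + 1 * Y \<omega>" for \<omega>
  have Z [measurable]: "Z \<in> borel_measurable M"
    unfolding Z_def by measurable
  note sq = std_normal_distributed_square[OF DX] std_normal_distributed_square[OF DY]
  have i: "integrable M X" "integrable M Y"
    using square_integrable_imp_integrable[of X] square_integrable_imp_integrable[of Y] sq by auto
  have iXY: "integrable M (\<lambda>\<omega>. X \<omega> * Y \<omega>)"
    using sq by (intro integrable_mult_if_square_integrable) auto
  have XY: "expectation (\<lambda>\<omega>. X \<omega> * Y \<omega>) = \<rho>"
    by (simp add: \<rho>_def correlation_std_normal[OF DX DY])
  have meanX: "expectation X = 0" and meanZ: "expectation Z = 0"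
    using DX[THEN standard_normal_distributed_expectation] DY[THEN standard_normal_distributed_expectation] i
    by (auto simp: Z_def[abs_def])
  have Z2: "integrable M (\<lambda>\<omega>. (Z \<omega>)\<^sup>2)" "expectation (\<lambda>\<omega>. (Z \<omega>)\<^sup>2) = 1 - \<rho>\<^sup>2"
    unfolding Z_def using expectation_square_linear_combination[of X Y "-\<rho>" 1] sq XY
    by (auto simp: power2_eq_square)
  have uncorr: "expectation (\<lambda>\<omega>. X \<omega> * Z \<omega>) = 0"
  proof -
    have "X \<omega> * Z \<omega> = X \<omega> * Y \<omega> - \<rho> * (X \<omega>)\<^sup>2" for \<omega>
      by (simp add: Z_def power2_eq_square algebra_simps)
    then show ?thesis
      using iXY sq XY by simp
  qed
  have normalZ: "normal_rv M (\<lambda>\<omega>. a * X \<omega> + b * Z \<omega>)" for a b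
    using normal[of "a - b * \<rho>" b] by (simp add: Z_def algebra_simps)
  have "1 - \<rho>\<^sup>2 \<noteq> 0"
    using corr by (auto simp: \<rho>_def power2_eq_1_iff abs_if)
  \<comment> \<open>The point-mass alternative of \<open>normal_rv\<close> would force
    \<open>Z = 0\<close> almost surely, against its second moment
    \<open>1 - \<rho>\<^sup>2\<close>.\<close>
  have "\<exists>\<mu> \<sigma>. 0 < \<sigma> \<and> distributed M lborel Z (normal_density \<mu> \<sigma>)"
  proof (rule ccontr)
    assume "\<not> ?thesis"
    then obtain \<mu> where \<mu>: "AE \<omega> in M. Z \<omega> = \<mu>"
      using normalZ[of 0 1] by (auto simp: normal_rv_def)
    have "expectation Z = expectation (\<lambda>_. \<mu>)"
      by (rule integral_cong_AE) (use \<mu> in auto)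
    moreover have "expectation (\<lambda>\<omega>. (Z \<omega>)\<^sup>2) = expectation (\<lambda>_. \<mu>\<^sup>2)"
      by (rule integral_cong_AE) (use \<mu> in auto)
    ultimately show False
      using meanZ Z2 \<open>1 - \<rho>\<^sup>2 \<noteq> 0\<close> by (simp add: prob_space)
  qed
  \<comment> \<open>The threshold leaves room for \<open>\<rho> * X\<close>, which is at least
    \<open>- \<bar>\<rho>\<bar> * c\<close> when \<open>\<bar>X\<bar> \<le> c\<close>; hence
    \<open>Y = Z + \<rho> * X\<close> still exceeds \<open>c\<close>.\<close>
  then have Zpos: "0 < prob (Z -` {(1 + \<bar>\<rho>\<bar>) * c<..} \<inter> space M)"
    using prob_normal_greaterThan_pos by blast
  have "{\<omega> \<in> space M. \<bar>X \<omega>\<bar> \<le> c} = X -` {-c..c} \<inter> space M"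
    by (auto simp: abs_le_iff)
  then have "0 < prob ((X -` {-c..c} \<inter> space M) \<inter> (Z -` {(1 + \<bar>\<rho>\<bar>) * c<..} \<inter> space M))"
    using pos Zpos
    by (subst prob_vimage_Int_eq_mult_if_uncorrelated_normal)
       (use sq Z2 meanX meanZ uncorr normalZ in auto)
  also have "\<dots> \<le> prob {\<omega> \<in> space M. \<bar>X \<omega>\<bar> \<le> c \<and> c < \<bar>Y \<omega>\<bar>}"
  proof (rule finite_measure_mono)
    have "c < \<bar>Y \<omega>\<bar>" if "-c \<le> X \<omega>" "X \<omega> \<le> c" "(1 + \<bar>\<rho>\<bar>) * c < Z \<omega>" for \<omega>
    proof -
      have "\<bar>\<rho> * X \<omega>\<bar> \<le> \<bar>\<rho>\<bar> * c"
        using that by (auto simp: abs_mult abs_le_iff intro!: mult_left_mono)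
      then show ?thesis
        using that(3) by (simp add: Z_def algebra_simps)
    qed
    then show "(X -` {-c..c} \<inter> space M) \<inter> (Z -` {(1 + \<bar>\<rho>\<bar>) * c<..} \<inter> space M) \<subseteq> {\<omega> \<in> space M. \<bar>X \<omega>\<bar> \<le> c \<and> c < \<bar>Y \<omega>\<bar>}"
      by (auto simp: abs_le_iff)
  qed measurable
  finally show ?thesis .
qed

section \<open>Unions of events of equal probability\<close>

text \<open>For every \<open>i\<close>, the union has probability \<open>\<alpha>\<close> plus that
  of its part outside \<open>R i\<close>. Equality therefore means that all these leftover parts are
  null.\<close>

lemma prob_UN_eq_iff_sym_diff_null:
  assumes I: "finite I" "I \<noteq> {}"
    and R: "\<And>i. i \<in> I \<Longrightarrow> R i \<in> events" and \<alpha>: "\<And>i. i \<in> I \<Longrightarrow> prob (R i) = \<alpha>"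
  shows "\<alpha> \<le> prob (\<Union>i\<in>I. R i)"
    and "prob (\<Union>i\<in>I. R i) = \<alpha> \<longleftrightarrow> (\<forall>i\<in>I. \<forall>j\<in>I. prob (sym_diff (R i) (R j)) = 0)"
proof -
  have U: "(\<Union>i\<in>I. R i) \<in> events"
    using I R by auto
  obtain k where k: "k \<in> I"
    using I by auto
  have split: "prob (\<Union>i\<in>I. R i) = \<alpha> + prob ((\<Union>i\<in>I. R i) - R i)" if "i \<in> I" for i
    using finite_measure_Diff[OF U R[OF that] UN_upper[OF that]] \<alpha>[OF that] by simp
  show "\<alpha> \<le> prob (\<Union>i\<in>I. R i)"
    using split[OF k] by simp
  show "prob (\<Union>i\<in>I. R i) = \<alpha> \<longleftrightarrow> (\<forall>i\<in>I. \<forall>j\<in>I. prob (sym_diff (R i) (R j)) = 0)"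
  proof (intro iffI ballI)
    fix i j
    assume eq: "prob (\<Union>i\<in>I. R i) = \<alpha>" and ij: "i \<in> I" "j \<in> I"
    \<comment> \<open>Each half of the symmetric difference lies in the part of the union left over
      by the other region.\<close>
    have "prob (sym_diff (R i) (R j)) \<le> prob (((\<Union>i\<in>I. R i) - R j) \<union> ((\<Union>i\<in>I. R i) - R i))"
      using ij U R by (intro finite_measure_mono) auto
    also have "\<dots> \<le> prob ((\<Union>i\<in>I. R i) - R j) + prob ((\<Union>i\<in>I. R i) - R i)"
      using ij U R by (intro measure_Un_le) auto
    also have "\<dots> = 0"
      using split ij eq by simp
    finally show "prob (sym_diff (R i) (R j)) = 0"
      by (simp add: measure_le_0_iff)
  next
    assume null: "\<forall>i\<in>I. \<forall>j\<in>I. prob (sym_diff (R i) (R j)) = 0"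
    \<comment> \<open>A point of the union outside the fixed region \<open>R k\<close> lies in some
      \<open>R i\<close>, hence in \<open>sym_diff (R i) (R k)\<close>; finitely many null sets
      remain null.\<close>
    have "prob ((\<Union>i\<in>I. R i) - R k) \<le> prob (\<Union>i\<in>I. sym_diff (R i) (R k))"
      using I R k by (intro finite_measure_mono) auto
    also have "\<dots> \<le> (\<Sum>i\<in>I. prob (sym_diff (R i) (R k)))"
      using I R k by (intro finite_measure_subadditive_finite) auto
    also have "\<dots> = 0"
      using null k by simp
    finally show "prob (\<Union>i\<in>I. R i) = \<alpha>"
      using split[OF k] by (simp add: measure_le_0_iff)
  qed
qed

section \<open>Two-sided regions and correlation\<close>

text \<open>A level below 1 gives the acceptance event of \<open>X\<close> positive probability, so
  without perfect correlation \<open>Y\<close> rejects on a non-null part of it. At level 1 both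
  regions would be almost sure whatever the correlation.\<close>

lemma sym_diff_null_iff_abs_correlation_1:
  fixes X Y :: "'a \<Rightarrow> real"
  assumes DX: "distributed M lborel X std_normal_density" and DY: "distributed M lborel Y std_normal_density"
    and normal: "\<And>a b. normal_rv M (\<lambda>\<omega>. a * X \<omega> + b * Y \<omega>)"
    and level: "prob {\<omega> \<in> space M. \<bar>X \<omega>\<bar> > c} < 1"
  shows "prob (sym_diff {\<omega> \<in> space M. \<bar>X \<omega>\<bar> > c} {\<omega> \<in> space M. \<bar>Y \<omega>\<bar> > c}) = 0 \<longleftrightarrow> \<bar>correlation M X Y\<bar> = 1"
proof
  have [measurable]: "X \<in> borel_measurable M" "Y \<in> borel_measurable M"
    using distributed_measurable[OF DX] distributed_measurable[OF DY] by simp_all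
  let ?S = "sym_diff {\<omega> \<in> space M. \<bar>X \<omega>\<bar> > c} {\<omega> \<in> space M. \<bar>Y \<omega>\<bar> > c}"
  {
    assume null: "prob ?S = 0"
    show "\<bar>correlation M X Y\<bar> = 1"
    proof (rule ccontr)
      assume corr: "\<bar>correlation M X Y\<bar> \<noteq> 1"
      have "prob {\<omega> \<in> space M. \<bar>X \<omega>\<bar> \<le> c} = 1 - prob {\<omega> \<in> space M. \<bar>X \<omega>\<bar> > c}"
        by (subst prob_compl[symmetric]) (auto intro!: arg_cong[where f=prob])
      then have "0 < prob {\<omega> \<in> space M. \<bar>X \<omega>\<bar> \<le> c \<and> c < \<bar>Y \<omega>\<bar>}"
        using level by (intro prob_abs_le_abs_greater_pos[OF DX DY normal corr]) simp
      also have "\<dots> \<le> prob ?S"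
        by (intro finite_measure_mono) auto
      finally show False
        using null by simp
    qed
  }
  assume "\<bar>correlation M X Y\<bar> = 1"
  then have "AE \<omega> in M. \<bar>X \<omega>\<bar> = \<bar>Y \<omega>\<bar>"
    by (rule AE_abs_eq_if_abs_correlation_1[OF DX DY])
  then have "AE \<omega> in M. \<omega> \<notin> ?S"
    by (auto elim!: eventually_mono)
  then show "prob ?S = 0"
    by (subst prob_eq_0) auto
qed

end

lemma jointly_normal_pair:
  assumes "jointly_normal M I T" "finite I" "i \<in> I" "j \<in> I"
  shows "normal_rv M (\<lambda>\<omega>. a * T i \<omega> + b * T j \<omega>)"
proof -
  \<comment> \<open>Coefficients given by a sum of two indicators also cover \<open>i = j\<close>,
    where the coefficient becomes \<open>a + b\<close>.\<close>
  have "(\<Sum>k\<in>I. ((if k = i then a else 0) + (if k = j then b else 0)) * T k \<omega>) = a * T i \<omega> + b * T j \<omega>" for \<omega>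
    using assms by (simp add: distrib_right sum.distrib if_distrib[of "\<lambda>x. x * _"] cong: if_cong)
  then show ?thesis
    using assms(1)[unfolded jointly_normal_def, rule_format, of "\<lambda>k. (if k = i then a else 0) + (if k = j then b else 0)"]
    by simp
qed

section \<open>The familywise error rate\<close>

text \<open>Two-sided regions ignore signs: \<open>T j = - T i\<close> has the same region as
  \<open>T i\<close> but correlation -1. The normal criterion is therefore
  \<open>\<bar>\<rho>\<bar> = 1\<close>, and it becomes \<open>\<rho> = 1\<close> once correlation
  -1 is excluded. The level condition on the regions \<open>R i\<close> makes \<open>c\<close> the
  critical value for \<open>\<alpha>\<close>.\<close>

theorem proposition2:
  fixes M :: "'a measure"
    and C :: nat
    and T :: "nat \<Rightarrow> 'a \<Rightarrow> real"
    and R :: "nat \<Rightarrow> 'a set"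
    and \<alpha> :: real
  assumes "prob_space M"
    and "1 \<le> C"
    and "\<And>i. i \<in> {1..C} \<Longrightarrow> T i \<in> borel_measurable M"
    and "\<And>i. i \<in> {1..C} \<Longrightarrow> R i \<in> sets M"
    and "\<And>i. i \<in> {1..C} \<Longrightarrow> measure M (R i) = \<alpha>"
  shows "fwer M {1..C} R = measure M (\<Union>i\<in>{1..C}. R i)
    \<and> fwer M {1..C} R \<ge> \<alpha>
    \<and> (fwer M {1..C} R = \<alpha> \<longleftrightarrow>
        (\<forall>i\<in>{1..C}. \<forall>j\<in>{1..C}. measure M (sym_diff (R i) (R j)) = 0))
    \<and> (\<forall>c::real.
        0 < \<alpha> \<and> \<alpha> < 1
        \<and> jointly_normal M {1..C} T
        \<and> (\<forall>i\<in>{1..C}. distributed M lborel (T i) std_normal_density)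
        \<and> (\<forall>i\<in>{1..C}. R i = {\<omega> \<in> space M. \<bar>T i \<omega>\<bar> > c})
        \<longrightarrow>
          (fwer M {1..C} R = \<alpha> \<longleftrightarrow>
            (\<forall>i\<in>{1..C}. \<forall>j\<in>{1..C}. \<bar>correlation M (T i) (T j)\<bar> = 1))
        \<and> ((\<forall>i\<in>{1..C}. \<forall>j\<in>{1..C}. correlation M (T i) (T j) \<noteq> -1) \<longrightarrow>
            (fwer M {1..C} R = \<alpha> \<longleftrightarrow>
              (\<forall>i\<in>{1..C}. \<forall>j\<in>{1..C}. correlation M (T i) (T j) = 1))))"
proof -
  interpret prob_space M by fact
  \<comment> \<open>The comprehension in \<open>fwer\<close> is cut down to \<open>space M\<close>,
    which already contains every measurable region.\<close>
  have UN: "fwer M {1..C} R = prob (\<Union>i\<in>{1..C}. R i)"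
    unfolding fwer_def using assms(4)[THEN sets.sets_into_space]
    by (intro arg_cong[where f=prob]) fastforce
  have I: "finite {1..C}" "{1..C} \<noteq> {}"
    using assms(2) by auto
  note union = prob_UN_eq_iff_sym_diff_null[where R=R, OF I assms(4,5), folded UN]
  have normal: "fwer M {1..C} R = \<alpha> \<longleftrightarrow> (\<forall>i\<in>{1..C}. \<forall>j\<in>{1..C}. \<bar>correlation M (T i) (T j)\<bar> = 1)"
    if \<alpha>: "\<alpha> < 1" and jn: "jointly_normal M {1..C} T"
      and D: "\<forall>i\<in>{1..C}. distributed M lborel (T i) std_normal_density"
      and R: "\<forall>i\<in>{1..C}. R i = {\<omega> \<in> space M. \<bar>T i \<omega>\<bar> > c}" for c
  proof -
    have "prob (sym_diff (R i) (R j)) = 0 \<longleftrightarrow> \<bar>correlation M (T i) (T j)\<bar> = 1"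
      if ij: "i \<in> {1..C}" "j \<in> {1..C}" for i j
      using sym_diff_null_iff_abs_correlation_1[of "T i" "T j" c] D ij R assms(5)[OF ij(1)] \<alpha>
        jointly_normal_pair[OF jn I(1) ij] by simp
    then show ?thesis
      using union(2) by simp
  qed
  show ?thesis
  proof (intro conjI allI impI; (elim conjE)?)
    fix c
    assume *: "\<alpha> < 1" "jointly_normal M {1..C} T"
      "\<forall>i\<in>{1..C}. distributed M lborel (T i) std_normal_density"
      "\<forall>i\<in>{1..C}. R i = {\<omega> \<in> space M. \<bar>T i \<omega>\<bar> > c}"
    show "fwer M {1..C} R = \<alpha> \<longleftrightarrow> (\<forall>i\<in>{1..C}. \<forall>j\<in>{1..C}. \<bar>correlation M (T i) (T j)\<bar> = 1)"
      by (rule normal[OF *])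
    assume "\<forall>i\<in>{1..C}. \<forall>j\<in>{1..C}. correlation M (T i) (T j) \<noteq> -1"
    then show "fwer M {1..C} R = \<alpha> \<longleftrightarrow> (\<forall>i\<in>{1..C}. \<forall>j\<in>{1..C}. correlation M (T i) (T j) = 1)"
      unfolding normal[OF *] by (auto simp: abs_if minus_equation_iff[of _ 1] split: if_splits)
  qed (use UN union in auto)
qed

end
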